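(* Let $0<r\le\min\{m,p\}$ and consider the fixed-rank manifold $\mathcal M_r=\{X\in\mathbb R^{m\times p}:\operatorname{rank}(X)=r\}$. Let $f:\mathbb R^{m\times p}\to\mathbb R$ be continuously differentiable, $X_t\in\mathcal M_r$, $\gamma_t>0$, and $h(X)=\frac14\|X\|^4+\frac12\|X\|^2$ with $\|\cdot\|$ the Frobenius norm. Then the direction $$V_t=\arg\min_{V\in\mathbb R^{m\times p}}\ \langle\operatorname{grad} f(X_t),V\rangle+\gamma_tD_h(X_t+V,X_t)$$ is also the solution of the tangent-space-constrained problem $$\min_{V\in\mathcal T_{X_t}\mathcal M_r}\ \langle\nabla f(X_t),V\rangle+\gamma_tD_h(X_t+V,X_t).$$
   Context: $\mathcal M_r$ is regarded as an embedded submanifold of $\mathbb R^{m\times p}$ with the Frobenius inner product $\langle\cdot,\cdot\rangle$; $\mathcal T_X\mathcal M_r$ is its tangent space (a linear subspace of $\mathbb R^{m\times p}$). $\operatorname{grad} f(X)$ is the orthogonal projection of the Euclidean gradient $\nabla f(X)$ onto $\mathcal T_X\mathcal M_r$. $D_h(Y,X)=h(Y)-h(X)-\langle\nabla h(X),Y-X\rangle$ is the Bregman distance. *)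

theory Defs
  imports "HOL-Analysis.Analysis"
begin

(* An m x p real matrix is an element of real^'p^'m. The library's inner product on this type
   is the sum of the entrywise products, i.e. the Frobenius inner product, and its norm is the
   Frobenius norm. *)

definition fixed_rank :: "nat \<Rightarrow> (real^'p^'m) set" where
  "fixed_rank r = {X. rank X = r}"

(* Meaningful where f is differentiable and the space is complete: then the representing
   vector D exists and is unique. *)
definition gradient :: "('a::real_inner \<Rightarrow> real) \<Rightarrow> 'a \<Rightarrow> 'a" where
  "gradient f x = (THE D. GDERIV f x :> D)"

definition cont_diff :: "('a::euclidean_space \<Rightarrow> real) \<Rightarrow> bool" where
  "cont_diff f \<longleftrightarrow> (\<forall>x. f differentiable (at x)) \<and> continuous_on UNIV (gradient f)"

(* Infinite differentiability on an open set I of parameters; d k is the k-th derivative. *)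
definition smooth_curve_on :: "real set \<Rightarrow> (real \<Rightarrow> 'a::real_normed_vector) \<Rightarrow> bool" where
  "smooth_curve_on I c \<longleftrightarrow>
     (\<exists>d. d 0 = c \<and> (\<forall>k. \<forall>t\<in>I. (d k has_vector_derivative d (Suc k) t) (at t)))"

(* Tangent space of an embedded submanifold S of a normed space, as a subset of that space:
   the initial velocities of smooth curves that stay in S and start at x. *)
definition tangent_space :: "'a::real_normed_vector set \<Rightarrow> 'a \<Rightarrow> 'a set" where
  "tangent_space S x =
     {v. \<exists>c e. e > 0 \<and> smooth_curve_on {-e<..<e} c \<and> c ` {-e<..<e} \<subseteq> S \<and>
               c 0 = x \<and> (c has_vector_derivative v) (at 0)}"

definition orth_proj :: "'a::real_inner set \<Rightarrow> 'a \<Rightarrow> 'a" where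
  "orth_proj T x = (THE y. y \<in> T \<and> (\<forall>w\<in>T. orthogonal (x - y) w))"

definition riem_grad :: "'a::real_inner set \<Rightarrow> ('a \<Rightarrow> real) \<Rightarrow> 'a \<Rightarrow> 'a" where
  "riem_grad S f x = orth_proj (tangent_space S x) (gradient f x)"

definition bregman :: "('a::real_inner \<Rightarrow> real) \<Rightarrow> 'a \<Rightarrow> 'a \<Rightarrow> real" where
  "bregman h y x = h y - h x - gradient h x \<bullet> (y - x)"

definition quartic_kernel :: "'a::real_normed_vector \<Rightarrow> real" where
  "quartic_kernel x = (1/4) * norm x ^ 4 + (1/2) * norm x ^ 2"

definition minimizers :: "('a \<Rightarrow> real) \<Rightarrow> 'a set \<Rightarrow> 'a set" where
  "minimizers F S = {v. is_arg_min F (\<lambda>w. w \<in> S) v}"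

end

theory Submission
  imports Defs
begin

text \<open>
  The tangent space \<open>T\<close> of the fixed-rank manifold at \<open>X\<close> is a linear subspace that contains
  \<open>X\<close> itself. On \<open>T\<close> the Euclidean and the Riemannian gradient \<open>g\<close> define the same linear
  functional, so the two objectives agree there. Since the gradient of the kernel \<open>h\<close> at \<open>Y\<close>
  is \<open>(\<parallel>Y\<parallel>\<^sup>2 + 1) Y\<close>, a multiple of \<open>Y\<close>, the unconstrained optimality condition
  \<open>\<nabla>h(X + V) = \<nabla>h(X) - g / \<gamma>\<close> makes \<open>X + V\<close> a multiple of a vector of \<open>T\<close>. Hence
  \<open>V \<in> T\<close>, and the unconstrained minimizer also solves the constrained problem.
\<close>

section \<open>Matrix products, generalized inverses and semicontinuity of the rank\<close>

lemma bounded_bilinear_matrix_matrix_mult: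
  "bounded_bilinear ((**) :: real^'n^'m \<Rightarrow> real^'p^'n \<Rightarrow> real^'p^'m)"
  \<comment> \<open>In finite dimension every bilinear map is bounded, so linearity in each factor
    suffices.\<close>
  unfolding bilinear_conv_bounded_bilinear [symmetric] bilinear_def
  by (auto intro!: linearI
      simp: matrix_matrix_mult_def vec_eq_iff algebra_simps sum.distrib sum_distrib_left)

interpretation matrix_mult: bounded_bilinear
  "(**) :: real^'n^'m \<Rightarrow> real^'p^'n \<Rightarrow> real^'p^'m"
  by (rule bounded_bilinear_matrix_matrix_mult)

text \<open>A linear right inverse of \<open>A\<close> on its range serves as \<open>G\<close>. Then
  \<open>A ** G\<close> is a projection onto the range of \<open>A\<close>, and
  \<open>mat 1 - G ** A\<close> is a projection onto its kernel.\<close>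

lemma matrix_generalized_inverse:
  fixes A :: "real^'p^'m"
  obtains G :: "real^'m^'p" where "A ** G ** A = A"
proof -
  obtain g where g: "linear g" "\<forall>v\<in>range ((*v) A). A *v g v = v"
    using linear_exists_right_inverse_on [OF matrix_vector_mul_linear [of A] subspace_UNIV] by auto
  have "A ** matrix g ** A = A"
    using g by (simp add: matrix_eq matrix_works matrix_vector_mul_assoc [symmetric])
  then show ?thesis by (rule that)
qed

lemma tendsto_det [tendsto_intros]:
  fixes A :: "'a \<Rightarrow> real^'n^'n"
  assumes "(A \<longlongrightarrow> L) F"
  shows "((\<lambda>t. det (A t)) \<longlongrightarrow> det L) F"
  unfolding det_def by (intro tendsto_intros assms)

lemma eventually_invertible:
  fixes A :: "'a \<Rightarrow> real^'n^'n"
  assumes "(A \<longlongrightarrow> mat 1) F"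
  shows "eventually (\<lambda>t. invertible (A t)) F"
  using tendsto_imp_eventually_ne [OF tendsto_det [OF assms], of 0]
  by (simp add: invertible_det_nz)

text \<open>With \<open>G\<close> a generalized inverse of \<open>L\<close>, the matrix
  \<open>B t\<close> tends to the identity, so some \<open>B t\<close> is invertible. Since
  \<open>G ** L\<close> is idempotent, \<open>B t ** (G ** L)\<close> equals
  \<open>G ** M t ** (G ** L)\<close>. Inverting \<open>B t\<close> and multiplying by
  \<open>L\<close> writes \<open>L\<close> as a product with \<open>M t\<close> as a factor.\<close>

lemma rank_lower_semicontinuous:
  fixes M :: "'a \<Rightarrow> real^'p^'m"
  assumes lim: "(M \<longlongrightarrow> L) F" and F: "F \<noteq> bot"
    and le: "eventually (\<lambda>t. rank (M t) \<le> r) F"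
  shows "rank L \<le> r"
proof -
  obtain G where G: "L ** G ** L = L" by (rule matrix_generalized_inverse)
  define B where "B = (\<lambda>t. mat 1 + G ** (M t - L))"
  have "(B \<longlongrightarrow> mat 1 + G ** (L - L)) F"
    unfolding B_def by (intro tendsto_intros matrix_mult.tendsto lim)
  then have "(B \<longlongrightarrow> mat 1) F" by (simp add: matrix_mult.zero_right)
  then have "eventually (\<lambda>t. invertible (B t)) F" by (rule eventually_invertible)
  with le have "eventually (\<lambda>t. rank (M t) \<le> r \<and> invertible (B t)) F"
    by (rule eventually_conj)
  then obtain t where t: "rank (M t) \<le> r" "invertible (B t)"
    using eventually_happens' [OF F] by blast
  then obtain C where C: "C ** B t = mat 1" unfolding invertible_def by blast
  have "B t ** (G ** L) = G ** M t ** (G ** L) + (G ** L - G ** (L ** G ** L))"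
    by (simp add: B_def matrix_mult.add_left matrix_mult.diff_left matrix_mult.diff_right
        matrix_mul_assoc)
  then have "B t ** (G ** L) = G ** M t ** (G ** L)" by (simp add: G)
  then have "C ** B t ** (G ** L) = C ** (G ** M t ** (G ** L))"
    by (simp add: matrix_mul_assoc [symmetric])
  then have "G ** L = C ** (G ** M t ** (G ** L))" by (simp add: C)
  then have "L ** (G ** L) = L ** (C ** (G ** M t ** (G ** L)))" by (rule arg_cong)
  then have "L = (L ** C ** G) ** (M t ** (G ** L))" by (simp only: matrix_mul_assoc G)
  then have "rank L \<le> rank (M t)"
    by (metis order_trans rank_mul_le_left rank_mul_le_right)
  with t show ?thesis by simp
qed

section \<open>Smooth curves and the tangent space of the fixed-rank manifold\<close>

lemma smooth_curve_on_quadratic: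
  "smooth_curve_on I (\<lambda>t. a + t *\<^sub>R b + (t * t) *\<^sub>R c)"
proof -
  define d where "d = (\<lambda>k::nat. \<lambda>t::real.
    if k = 0 then a + t *\<^sub>R b + (t * t) *\<^sub>R c
    else if k = 1 then b + (2 * t) *\<^sub>R c
    else if k = 2 then 2 *\<^sub>R c else 0)"
  have "(d k has_vector_derivative d (Suc k) t) (at t)" for k t
  proof -
    consider "k = 0" | "k = 1" | "k \<ge> 2" by linarith
    then show ?thesis
      by cases (auto simp: d_def numeral_2_eq_2 intro!: derivative_eq_intros)
  qed
  moreover have "d 0 = (\<lambda>t. a + t *\<^sub>R b + (t * t) *\<^sub>R c)" by (simp add: d_def)
  ultimately show ?thesis unfolding smooth_curve_on_def by blast
qed

lemma has_vector_derivative_at_0_tendsto: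
  assumes "(c has_vector_derivative v) (at 0)"
  shows "((\<lambda>t. (1 / t) *\<^sub>R (c t - c 0)) \<longlongrightarrow> v) (at 0)"
proof -
  have "((\<lambda>t. norm (((c t - c 0) - t *\<^sub>R v) /\<^sub>R norm t)) \<longlongrightarrow> 0) (at 0)"
    using assms unfolding has_vector_derivative_def has_derivative_at_within
    by (intro tendsto_norm_zero) simp
  moreover have "norm (((c t - c 0) - t *\<^sub>R v) /\<^sub>R norm t) = norm ((1 / t) *\<^sub>R (c t - c 0) - v)"
    if "t \<noteq> 0" for t
  proof -
    have "(1 / t) *\<^sub>R (c t - c 0) - v = (1 / t) *\<^sub>R ((c t - c 0) - t *\<^sub>R v)"
      using that by (simp add: scaleR_diff_right)
    then show ?thesis by (simp add: divide_inverse)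
  qed
  ultimately have "((\<lambda>t. norm ((1 / t) *\<^sub>R (c t - c 0) - v)) \<longlongrightarrow> 0) (at 0)"
    by (elim Lim_transform_eventually) (simp add: eventually_at_filter)
  then show ?thesis by (simp add: tendsto_norm_zero_iff LIM_zero_iff)
qed

text \<open>The equation says that \<open>V\<close> maps the kernel of \<open>X\<close> into the
  range of \<open>X\<close>, whichever generalized inverse \<open>G\<close> is chosen. For
  velocities of curves this follows from semicontinuity of the rank; conversely, an explicit
  quadratic curve has velocity \<open>V\<close>.\<close>

lemma tangent_space_fixed_rank:
  fixes X :: "real^'p^'m"
  assumes X: "X \<in> fixed_rank r" and G: "X ** G ** X = X"
  shows "tangent_space (fixed_rank r) X =
    {V. (mat 1 - X ** G) ** V ** (mat 1 - G ** X) = 0}"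
proof (intro set_eqI iffI; clarify?)
  fix V assume "V \<in> tangent_space (fixed_rank r) X"
  then obtain c e where e: "e > 0" and sub: "c ` {-e<..<e} \<subseteq> fixed_rank r"
    and c0: "c 0 = X" and der: "(c has_vector_derivative V) (at 0)"
    unfolding tangent_space_def by blast
  define E where "E = mat 1 - G ** X"
  have XE: "X ** E = 0"
    by (simp add: E_def matrix_mult.diff_right matrix_mul_assoc G)
  have EE: "E ** E = E"
  proof -
    have "(G ** X) ** E = 0" by (simp add: matrix_mul_assoc [symmetric] XE matrix_mult.zero_right)
    then show ?thesis by (subst E_def) (simp add: matrix_mult.diff_left)
  qed
  have "((\<lambda>t. (1 / t) *\<^sub>R (c t - X)) \<longlongrightarrow> V) (at 0)"
    using has_vector_derivative_at_0_tendsto [OF der] by (simp add: c0)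
  moreover have "(c \<longlongrightarrow> X) (at 0)"
    using has_vector_derivative_continuous [OF der] by (simp add: continuous_at c0)
  ultimately have "((\<lambda>t::real. c t + ((1 / t) *\<^sub>R (c t - X)) ** E) \<longlongrightarrow> X + V ** E) (at 0)"
    by (intro tendsto_intros matrix_mult.tendsto)
  moreover have "c t + ((1 / t) *\<^sub>R (c t - X)) ** E = c t ** (mat 1 + (1 / t) *\<^sub>R E)" for t :: real
    by (simp add: matrix_mult.scaleR_left matrix_mult.scaleR_right matrix_mult.diff_left
        matrix_mult.add_right XE)
  txt \<open>As \<open>X ** E = 0\<close>, a right factor that blows up on the kernel of \<open>X\<close> brings the velocity
    \<open>V ** E\<close> into the limit without increasing the rank.\<close>
  ultimately have lim: "((\<lambda>t::real. c t ** (mat 1 + (1 / t) *\<^sub>R E)) \<longlongrightarrow> X + V ** E) (at 0)"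
    by simp
  have "eventually (\<lambda>t::real. rank (c t ** (mat 1 + (1 / t) *\<^sub>R E)) \<le> r) (at 0)"
    unfolding eventually_at
  proof (intro exI conjI ballI impI)
    fix t :: real assume "t \<noteq> 0 \<and> dist t 0 < e"
    then have "c t \<in> fixed_rank r" using sub by (auto simp: image_subset_iff abs_less_iff dist_real_def)
    then show "rank (c t ** (mat 1 + (1 / t) *\<^sub>R E)) \<le> r"
      using rank_mul_le_left [of "c t"] by (simp add: fixed_rank_def)
  qed (rule e)
  then have rk: "rank (X + V ** E) \<le> rank X"
    using X by (intro rank_lower_semicontinuous [OF lim]) (auto simp: fixed_rank_def)
  \<comment> \<open>Removing the \<open>E\<close> part on the right recovers \<open>X\<close>, so
    the range of \<open>X\<close> lies in that of \<open>X + V ** E\<close>. The rank bound turns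
    this inclusion into equality.\<close>
  have "(X + V ** E) ** (mat 1 - E) = X"
    by (simp add: matrix_mult.add_left matrix_mult.diff_right XE matrix_mul_assoc [symmetric] EE)
  then have "range ((*v) X) \<subseteq> range ((*v) (X + V ** E))"
    by (metis (no_types, lifting) image_subsetI matrix_vector_mul_assoc rangeI)
  with rk have eq: "range ((*v) X) = range ((*v) (X + V ** E))"
    unfolding rank_dim_range
    by (intro subspace_dim_equal) (auto intro!: linear_subspace_image)
  have "((mat 1 - X ** G) ** (V ** E)) *v u = 0" for u
  proof -
    \<comment> \<open>On vectors \<open>E *v u\<close> of the kernel of \<open>X\<close> the summand
      \<open>X\<close> vanishes, so the range of \<open>V ** E\<close> lies in that of
      \<open>X + V ** E\<close>, hence in that of \<open>X\<close>, which
      \<open>mat 1 - X ** G\<close> annihilates.\<close>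
    have "(V ** E) *v u = (X + V ** E) *v (E *v u)"
      by (simp add: matrix_vector_mul_assoc matrix_mult.add_left XE matrix_mul_assoc [symmetric] EE)
    then obtain w where w: "(V ** E) *v u = X *v w" using eq by (metis imageE rangeI)
    have "((mat 1 - X ** G) ** (V ** E)) *v u = (mat 1 - X ** G) *v ((V ** E) *v u)"
      by (simp only: matrix_vector_mul_assoc)
    also have "\<dots> = ((mat 1 - X ** G) ** X) *v w"
      by (simp only: w matrix_vector_mul_assoc)
    finally show ?thesis by (simp add: matrix_mult.diff_left G)
  qed
  then show "(mat 1 - X ** G) ** V ** (mat 1 - G ** X) = 0"
    by (simp add: matrix_eq matrix_mul_assoc E_def)
next
  fix V assume V: "(mat 1 - X ** G) ** V ** (mat 1 - G ** X) = 0"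
  \<comment> \<open>Expanding the equation gives
    \<open>V = V ** G ** X - X ** G ** V ** G ** X + X ** G ** V\<close>; the terms ending in
    \<open>X\<close> yield \<open>A\<close>, the last one yields \<open>B\<close>.\<close>
  define B where "B = G ** V"
  define A where "A = V ** G - X ** G ** V ** G"
  have dec: "V = A ** X + X ** B"
    using V by (simp add: A_def B_def matrix_mult.diff_left matrix_mult.diff_right matrix_mul_assoc
        diff_eq_eq)
  \<comment> \<open>The quadratic term is chosen so that \<open>c t\<close> factors as
    \<open>X\<close> between two perturbations of the identity. These are invertible for small
    \<open>t\<close>, which keeps the rank constant.\<close>
  define c where "c = (\<lambda>t. X + t *\<^sub>R V + (t * t) *\<^sub>R (A ** X ** B))"
  have c_eq: "c t = (mat 1 + t *\<^sub>R A) ** X ** (mat 1 + t *\<^sub>R B)" for t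
    by (simp add: c_def dec matrix_mult.add_left matrix_mult.add_right matrix_mult.scaleR_left
        matrix_mult.scaleR_right scaleR_add_right)
  have inv: "eventually (\<lambda>t. invertible (mat 1 + t *\<^sub>R C)) (at (0::real))" for C :: "real^'n^'n"
    by (rule eventually_invertible) (auto intro!: tendsto_eq_intros)
  have "eventually (\<lambda>t. rank (c t) = r) (at 0)"
    using inv [of A] inv [of B]
  proof eventually_elim
    case (elim t)
    obtain A' B' where A': "A' ** (mat 1 + t *\<^sub>R A) = mat 1" and B': "(mat 1 + t *\<^sub>R B) ** B' = mat 1"
      using elim unfolding invertible_def by blast
    have "A' ** c t ** B' = (A' ** (mat 1 + t *\<^sub>R A)) ** X ** ((mat 1 + t *\<^sub>R B) ** B')"
      by (simp only: c_eq matrix_mul_assoc)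
    then have "X = A' ** c t ** B'" by (simp add: A' B')
    then have "rank X \<le> rank (c t)"
      by (metis order_trans rank_mul_le_left rank_mul_le_right)
    moreover have "rank (c t) \<le> rank X"
      unfolding c_eq by (metis order_trans rank_mul_le_left rank_mul_le_right)
    ultimately show ?case using X by (simp add: fixed_rank_def)
  qed
  then obtain e where e: "e > 0" and rk: "\<And>t. t \<noteq> 0 \<Longrightarrow> dist t 0 < e \<Longrightarrow> rank (c t) = r"
    unfolding eventually_at by auto
  have c0: "c 0 = X" by (simp add: c_def)
  \<comment> \<open>The filter \<open>at 0\<close> gives no information at \<open>t = 0\<close>
    itself, where the curve passes through \<open>X\<close>.\<close>
  have "c t \<in> fixed_rank r" if "t \<in> {-e<..<e}" for t
    using rk [of t] X c0 that by (cases "t = 0") (auto simp: fixed_rank_def)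
  moreover have "(c has_vector_derivative V) (at 0)"
    unfolding c_def by (auto intro!: derivative_eq_intros)
  ultimately show "V \<in> tangent_space (fixed_rank r) X"
    using e c0 smooth_curve_on_quadratic [of "{-e<..<e}" X V "A ** X ** B"]
    unfolding tangent_space_def c_def [symmetric] by blast
qed

lemma subspace_tangent_space_fixed_rank:
  fixes X :: "real^'p^'m"
  assumes "X \<in> fixed_rank r"
  shows "subspace (tangent_space (fixed_rank r) X)" and "X \<in> tangent_space (fixed_rank r) X"
proof -
  obtain G where G: "X ** G ** X = X" by (rule matrix_generalized_inverse)
  note T = tangent_space_fixed_rank [OF assms G]
  show "subspace (tangent_space (fixed_rank r) X)"
    unfolding T subspace_def
    by (simp add: matrix_mult.add_left matrix_mult.add_right matrix_mult.scaleR_left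
        matrix_mult.scaleR_right matrix_mult.zero_left matrix_mult.zero_right)
  show "X \<in> tangent_space (fixed_rank r) X"
    unfolding T by (simp add: matrix_mult.diff_left G matrix_mult.zero_left)
qed

section \<open>Orthogonal projection, gradients and the quartic kernel\<close>

lemma orth_proj_subspace:
  fixes T :: "'a::euclidean_space set"
  assumes T: "subspace T"
  shows "orth_proj T x \<in> T" and "w \<in> T \<Longrightarrow> orthogonal (x - orth_proj T x) w"
proof -
  obtain y z where y: "y \<in> span T" and z: "\<And>w. w \<in> span T \<Longrightarrow> orthogonal z w" and x: "x = y + z"
    using orthogonal_subspace_decomp_exists [of T x] by metis
  have *: "y \<in> T \<and> (\<forall>w\<in>T. orthogonal (x - y) w)"
    using y z x T by (metis add_diff_cancel_left' span_eq_iff)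
  have "orth_proj T x \<in> T \<and> (\<forall>w\<in>T. orthogonal (x - orth_proj T x) w)"
    unfolding orth_proj_def
  proof (rule theI [where a = y])
    show "y \<in> T \<and> (\<forall>w\<in>T. orthogonal (x - y) w)" by (rule *)
    \<comment> \<open>Uniqueness: the difference of two candidates lies in \<open>T\<close> and is
      orthogonal to itself.\<close>
    fix y' assume y': "y' \<in> T \<and> (\<forall>w\<in>T. orthogonal (x - y') w)"
    have "y - y' \<in> T" using * y' T by (simp add: subspace_diff)
    then have "(x - y') \<bullet> (y - y') = 0" "(x - y) \<bullet> (y - y') = 0"
      using * y' by (auto simp: orthogonal_def)
    then have "(y - y') \<bullet> (y - y') = 0" by (simp add: inner_diff_left)
    then show "y' = y" by simp
  qed
  then show "orth_proj T x \<in> T" and "w \<in> T \<Longrightarrow> orthogonal (x - orth_proj T x) w" by auto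
qed

text \<open>The derivative is a unique linear functional, and testing two representing vectors on
  their difference shows that they coincide, which resolves the \<open>THE\<close>.\<close>

lemma gradient_eqI:
  assumes "GDERIV f x :> D"
  shows "gradient f x = D"
  unfolding gradient_def
proof (rule the_equality [where P = "\<lambda>D. GDERIV f x :> D", OF assms])
  fix D' assume "GDERIV f x :> D'"
  then have "(\<lambda>h. h \<bullet> D') = (\<lambda>h. h \<bullet> D)"
    using assms unfolding gderiv_def by (rule has_derivative_unique)
  then have "(D' - D) \<bullet> D' = (D' - D) \<bullet> D" by metis
  then have "(D' - D) \<bullet> (D' - D) = 0" by (simp add: inner_diff_right)
  then show "D' = D" by simp
qed

lemma quartic_kernel_eq_inner:
  "quartic_kernel x = (1/4) * (x \<bullet> x)\<^sup>2 + (1/2) * (x \<bullet> x)"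
  by (simp add: quartic_kernel_def power2_norm_eq_inner [symmetric] power_mult [symmetric])

lemma gradient_quartic_kernel:
  "gradient quartic_kernel x = (x \<bullet> x + 1) *\<^sub>R x"
  unfolding quartic_kernel_eq_inner [abs_def]
  by (rule gradient_eqI)
    (auto simp: gderiv_def algebra_simps inner_commute intro!: derivative_eq_intros)

text \<open>The Bregman distance splits exactly into three nonnegative terms, the last being the
  bound. It gives the strict inequality behind uniqueness of the minimizer.\<close>

lemma bregman_quartic_kernel_ge:
  "bregman quartic_kernel z y \<ge> (1/2) * (norm (z - y))\<^sup>2"
proof -
  have "bregman quartic_kernel z y =
      (1/4) * (z \<bullet> z - y \<bullet> y)\<^sup>2 + (1/2) * (y \<bullet> y) * ((z - y) \<bullet> (z - y)) + (1/2) * ((z - y) \<bullet> (z - y))"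
    unfolding bregman_def quartic_kernel_eq_inner gradient_quartic_kernel
    by (simp add: inner_commute power2_eq_square inner_diff_left inner_diff_right inner_add_right field_simps)
  then show ?thesis by (simp add: power2_norm_eq_inner)
qed

text \<open>The gradient of the kernel preserves lines through the origin, so inverting it reduces
  to the scalar cubic \<open>p s = 1\<close>. A root exists in the unit interval because
  \<open>p 0 = 0\<close> and \<open>p 1 = b \<bullet> b + 1\<close>.\<close>

lemma ex_scaled_gradient_quartic_kernel:
  fixes b :: "'a::real_inner"
  obtains s where "gradient quartic_kernel (s *\<^sub>R b) = b"
proof -
  define p where "p = (\<lambda>s::real. (s * s * (b \<bullet> b) + 1) * s)"
  have "\<exists>s\<ge>0. s \<le> 1 \<and> p s = 1"
    by (rule IVT') (auto simp: p_def intro!: continuous_intros)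
  then obtain s where "p s = 1" by blast
  then have "gradient quartic_kernel (s *\<^sub>R b) = b"
    by (simp add: gradient_quartic_kernel p_def mult.assoc)
  then show ?thesis by (rule that)
qed

section \<open>Comparison of the two minimization problems\<close>

lemma minimizers_eq_singleton:
  fixes F :: "'a \<Rightarrow> real"
  assumes "v \<in> S" and "\<And>w. w \<in> S \<Longrightarrow> w \<noteq> v \<Longrightarrow> F v < F w"
  shows "minimizers F S = {v}"
  using assms unfolding minimizers_def is_arg_min_def
  by (auto simp: set_eq_iff) (metis order_less_irrefl order_less_asym)+

theorem proposition4p1:
  fixes f :: "real^'p^'m \<Rightarrow> real" and X :: "real^'p^'m" and \<gamma> :: real and r :: nat
  assumes "0 < r" and "r \<le> min CARD('m) CARD('p)"
    and "cont_diff f"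
    and "X \<in> fixed_rank r"
    and "\<gamma> > 0"
  shows "\<exists>V. minimizers (\<lambda>V. riem_grad (fixed_rank r) f X \<bullet> V
                              + \<gamma> * bregman quartic_kernel (X + V) X) UNIV = {V}
           \<and> minimizers (\<lambda>V. gradient f X \<bullet> V
                              + \<gamma> * bregman quartic_kernel (X + V) X)
                         (tangent_space (fixed_rank r) X) = {V}"
proof -
  define T where "T = tangent_space (fixed_rank r) X"
  define g where "g = riem_grad (fixed_rank r) f X"
  define D where "D = gradient quartic_kernel X"
  define F where "F = (\<lambda>V. g \<bullet> V + \<gamma> * bregman quartic_kernel (X + V) X)"
  define F' where "F' = (\<lambda>V. gradient f X \<bullet> V + \<gamma> * bregman quartic_kernel (X + V) X)"
  have T: "subspace T" and XT: "X \<in> T"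
    using subspace_tangent_space_fixed_rank [OF \<open>X \<in> fixed_rank r\<close>] by (simp_all add: T_def)
  have g: "g = orth_proj T (gradient f X)" by (simp add: g_def riem_grad_def T_def)
  have gT: "g \<in> T" unfolding g by (rule orth_proj_subspace(1) [OF T])
  have orth: "gradient f X \<bullet> w = g \<bullet> w" if "w \<in> T" for w
    using orth_proj_subspace(2) [OF T that, of "gradient f X"]
    by (simp add: g orthogonal_def inner_diff_left)
  \<comment> \<open>\<open>b\<close> is the value that stationarity of \<open>F\<close> prescribes
    for the kernel gradient at \<open>Y = X + V\<close>.\<close>
  define b where "b = D - (1 / \<gamma>) *\<^sub>R g"
  obtain s where s: "gradient quartic_kernel (s *\<^sub>R b) = b"
    by (rule ex_scaled_gradient_quartic_kernel)
  define Y where "Y = s *\<^sub>R b"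
  define V where "V = Y - X"
  have VT: "V \<in> T"
    using T XT gT
    by (simp add: V_def Y_def b_def D_def gradient_quartic_kernel subspace_diff subspace_mul)
  have g_eq: "g = \<gamma> *\<^sub>R (D - b)" using \<open>\<gamma> > 0\<close> by (simp add: b_def)
  \<comment> \<open>Since \<open>g\<close> is \<open>\<gamma>\<close> times \<open>D - b\<close> and
    \<open>b\<close> is the kernel gradient at \<open>Y\<close>, the linear terms combine into a
    Bregman distance with base point \<open>Y\<close>. Global optimality of \<open>V\<close> thus
    follows without differentiating \<open>F\<close>.\<close>
  have F_diff: "F W - F V = \<gamma> * bregman quartic_kernel (X + W) Y" for W
    using s by (simp add: F_def g_eq bregman_def V_def Y_def [symmetric] D_def [symmetric]
        algebra_simps inner_diff_left inner_diff_right inner_add_right)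
  have F_less: "F V < F W" if "W \<noteq> V" for W
  proof -
    have "X + W - Y \<noteq> 0" using that by (simp add: V_def algebra_simps)
    then have "0 < (1/2) * (norm (X + W - Y))\<^sup>2" by simp
    also have "\<dots> \<le> bregman quartic_kernel (X + W) Y" by (rule bregman_quartic_kernel_ge)
    finally show ?thesis using F_diff [of W] \<open>\<gamma> > 0\<close> by (simp add: algebra_simps)
  qed
  have "F' W = F W" if "W \<in> T" for W
    using orth [OF that] by (simp add: F_def F'_def)
  \<comment> \<open>The strict inequality on the whole space restricts to \<open>T\<close>, which
    contains \<open>V\<close> and on which \<open>F'\<close> agrees with \<open>F\<close>.\<close>
  then have "minimizers F UNIV = {V}" "minimizers F' T = {V}"
    using F_less VT by (auto intro!: minimizers_eq_singleton)
  then show ?thesis unfolding F_def F'_def g_def T_def by blast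
qed

end
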